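(* In the probabilistic model described in the context, fix an integer $d \geq 0$. Then the sequence $\{ \mathbf{M}_{\mathbf{f},k}(d) \}_{k=2}^{\infty}$ is bounded with probability 1.
   Context: Let $A:\mathbb{N}\to\mathbb{R}_{>0}$ satisfy $A(n)\to\infty$ and $\sum_{n\ge1} A(n)^{-1/2}<\infty$. Let $\{\varepsilon_n\}$ be positive reals with $\varepsilon_n\to0$ and $\varepsilon_n \gg \frac{\log A(n)}{\sqrt{A(n)}}$ as $n\to\infty$ (where $u_n\gg v_n$ means $u_n \ge C v_n$ for some constant $C>0$ and all large $n$). Let $\mathcal{S}_n = \{x\in \mathbb{N} : A(n)(1 - \varepsilon_n) \leq x \leq A(n) (1 + \varepsilon_n) \}$ and let $\mathbf{f}_n$ be a random variable uniformly distributed on $\mathcal{S}_n$. Define $\mathbf{\Delta}_{\mathbf{f},k}(n) := \min \{ | \mathbf{f}_n- m^k| : m \in \mathbb{Z} \}$ and $\mathbf{M}_{\mathbf{f}, k}(d) := \max \{ n \in \mathbb{N} : \mathbf{\Delta}_{\mathbf{f}, k}(n) \leq d \}$, with value $\infty$ if no maximum exists.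
   Formalization: M_{f,k}(d) is taken to be 0, not ∞, when no n satisfies Δ_{f,k}(n) ≤ d; with the value ∞ for the empty set the claim fails (e.g. d = 0 and all f_n ≥ 2, where for large k almost surely no f_n is a k-th power). *)

theory Defs
  imports "HOL-Probability.Probability"
begin

text \<open>The natural numbers of the model start at 1, so \<open>x\<close> and the index \<open>n\<close> below
  are restricted to positive values; the values at index 0 are irrelevant.\<close>

definition sample_set :: "(nat \<Rightarrow> real) \<Rightarrow> (nat \<Rightarrow> real) \<Rightarrow> nat \<Rightarrow> nat set" where
  "sample_set A \<epsilon> n =
     {x. 1 \<le> x \<and> A n * (1 - \<epsilon> n) \<le> real x \<and> real x \<le> A n * (1 + \<epsilon> n)}"

text \<open>On \<open>nat\<close>, the infimum of a nonempty set is its minimum.\<close>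

definition power_dist :: "(nat \<Rightarrow> nat) \<Rightarrow> nat \<Rightarrow> nat \<Rightarrow> nat" where
  "power_dist g k n = (INF m::int. nat \<bar>int (g n) - m ^ k\<bar>)"

text \<open>The value \<open>\<infinity>\<close> stands for the absence of a maximum because there are infinitely many
  such \<open>n\<close>. If there is no such \<open>n\<close> at all, the value is 0, the supremum of the empty set.\<close>

definition max_index :: "(nat \<Rightarrow> nat) \<Rightarrow> nat \<Rightarrow> nat \<Rightarrow> enat" where
  "max_index g k d =
     (let N = {n. 1 \<le> n \<and> power_dist g k n \<le> d}
      in if N = {} then 0 else if finite N then enat (Max N) else \<infinity>)"

end

theory Submission
  imports Defs "HOL-Computational_Algebra.Nth_Powers" "HOL-Real_Asymp.Real_Asymp"
begin

text \<open>By Borel--Cantelli it suffices to bound the probability that \<open>f\<^sub>n\<close> lies within \<open>d\<close> of some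
  perfect power by a constant multiple of \<open>A(n)\<^sup>-\<^sup>1\<^sup>/\<^sup>2\<close>. The window around \<open>a = A(n)\<close> has length
  about \<open>\<epsilon>a\<close>. It contains \<open>O(\<epsilon>a\<^sup>1\<^sup>/\<^sup>2 + 1)\<close> squares and, for each of the \<open>O(log a)\<close> relevant exponents
  \<open>k \<ge> 3\<close>, at most \<open>O(\<epsilon>a\<^sup>1\<^sup>/\<^sup>3 + 1)\<close> perfect \<open>k\<close>-th powers. Treating the squares separately keeps the
  logarithm away from the main term \<open>\<epsilon>a\<^sup>1\<^sup>/\<^sup>2\<close>, and the lower bound on \<open>\<epsilon>\<close> absorbs the
  contribution \<open>O(log a)\<close> of the summands \<open>1\<close>.\<close>

definition nats_between :: "real \<Rightarrow> real \<Rightarrow> nat set" where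
  "nats_between l u = real -` {l..u}"

lemma mem_nats_between_iff [simp]: "n \<in> nats_between l u \<longleftrightarrow> l \<le> real n \<and> real n \<le> u"
  by (simp add: nats_between_def)

lemma nats_between_eq_atLeastAtMost:
  assumes "0 \<le> u"
  shows "nats_between l u = {nat \<lceil>l\<rceil>..nat \<lfloor>u\<rfloor>}"
  using assms by (auto simp: le_nat_floor) linarith

lemma nats_between_eq_empty: "u < 0 \<Longrightarrow> nats_between l u = {}"
  by (auto simp: nats_between_def)

lemma finite_nats_between [simp]: "finite (nats_between l u)"
  by (cases "0 \<le> u") (simp_all add: nats_between_eq_atLeastAtMost nats_between_eq_empty)

lemma card_nats_between_le:
  assumes "l \<le> u"
  shows "real (card (nats_between l u)) \<le> u - l + 1"
proof (cases "0 \<le> u")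
  case True
  with assms show ?thesis
    by (simp add: nats_between_eq_atLeastAtMost) linarith
next
  case False
  with assms show ?thesis
    by (simp add: nats_between_eq_empty)
qed

lemma card_nats_between_ge:
  assumes "0 \<le> l"
  shows "u - l - 1 \<le> real (card (nats_between l u))"
proof (cases "0 \<le> u")
  case True
  with assms show ?thesis
    by (simp add: nats_between_eq_atLeastAtMost) linarith
next
  case False
  with assms show ?thesis
    by (simp add: nats_between_eq_empty)
qed

lemma root_diff_le:
  fixes x y :: real
  assumes "0 < x" "x \<le> y" "k \<ge> 1"
  shows "root k y - root k x \<le> (y - x) / x powr (1 - 1 / k)"
proof -
  have "root k (y / x) \<le> root 1 (y / x)"
    using assms by (intro real_root_decreasing) auto
  then have "root k y / root k x \<le> y / x"
    by (simp add: real_root_divide)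
  then have "root k y - root k x \<le> root k x * (y / x) - root k x"
    using assms by (simp add: pos_divide_le_eq mult.commute)
  also have "\<dots> = (y - x) / (x / root k x)"
    using assms by (simp add: field_simps)
  also have "x / root k x = x powr (1 - 1 / k)"
    using assms by (simp add: powr_diff root_powr_inverse)
  finally show ?thesis .
qed

lemma nth_powers_between_eq_image:
  assumes "k \<ge> 1" "0 \<le> L" "L \<le> U"
  shows "Collect (is_nth_power k) \<inter> nats_between L U =
    (\<lambda>m. m ^ k) ` nats_between (root k L) (root k U)"
proof -
  have "m ^ k \<in> nats_between L U \<longleftrightarrow> m \<in> nats_between (root k L) (root k U)" for m
    using assms real_root_le_iff[of k L "real m ^ k"] real_root_le_iff[of k "real m ^ k" U]
    by (simp add: real_root_power_cancel)
  then show ?thesis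
    by (fastforce elim: is_nth_powerE)
qed

lemma card_nth_powers_between_le:
  assumes "k \<ge> 1" "1 \<le> L" "L \<le> U" "s \<le> 1 - 1 / k"
  shows "real (card (Collect (is_nth_power k) \<inter> nats_between L U)) \<le> (U - L) / L powr s + 1"
proof -
  have "card (Collect (is_nth_power k) \<inter> nats_between L U)
      \<le> card (nats_between (root k L) (root k U))"
    using assms by (simp add: nth_powers_between_eq_image card_image_le)
  also have "real \<dots> \<le> root k U - root k L + 1"
    using assms by (intro card_nats_between_le) simp
  also have "root k U - root k L \<le> (U - L) / L powr (1 - 1 / k)"
    using assms by (intro root_diff_le) auto
  also have "\<dots> \<le> (U - L) / L powr s"
    using assms by (intro divide_left_mono powr_mono) auto
  finally show ?thesis by simp
qed

lemma exponent_le_log2: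
  fixes x :: nat
  assumes "is_nth_power k x" "1 < x"
  shows "real k \<le> log 2 (real x)"
proof -
  obtain m where m: "x = m ^ k"
    using assms(1) by (rule is_nth_powerE)
  have "m \<noteq> 0" "m \<noteq> 1"
    using assms(2) unfolding m by (intro notI; simp add: power_0_left split: if_splits)+
  then have "2 ^ k \<le> real m ^ k"
    by (intro power_mono) auto
  then show ?thesis
    by (simp add: m le_log_of_power)
qed

definition perfect_powers :: "nat set" where
  "perfect_powers = {x. \<exists>k\<ge>2. is_nth_power k x}"

lemma perfect_powers_between_subset:
  assumes "1 < L"
  shows "perfect_powers \<inter> nats_between L U \<subseteq>
    (\<Union>k\<in>insert 2 {3..nat \<lfloor>log 2 U\<rfloor>}. Collect (is_nth_power k) \<inter> nats_between L U)"
proof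
  fix x assume x: "x \<in> perfect_powers \<inter> nats_between L U"
  then obtain k where k: "k \<ge> 2" "is_nth_power k x"
    by (auto simp: perfect_powers_def)
  have "real k \<le> log 2 (real x)"
    using x k(2) assms by (intro exponent_le_log2) auto
  also have "\<dots> \<le> log 2 U"
    using x assms by simp
  finally have "k \<le> nat \<lfloor>log 2 U\<rfloor>"
    by (rule le_nat_floor)
  with k(1) have "k \<in> insert 2 {3..nat \<lfloor>log 2 U\<rfloor>}"
    by auto
  with x k(2) show "x \<in> (\<Union>k\<in>insert 2 {3..nat \<lfloor>log 2 U\<rfloor>}.
      Collect (is_nth_power k) \<inter> nats_between L U)"
    by blast
qed

lemma card_perfect_powers_between_le:
  assumes "1 < L" "L \<le> U"
  shows "real (card (perfect_powers \<inter> nats_between L U)) \<le>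
    (U - L) / sqrt L + 1 + log 2 U * ((U - L) / L powr (2/3) + 1)"
proof -
  define K where "K = nat \<lfloor>log 2 U\<rfloor>"
  define c where "c k = card (Collect (is_nth_power k) \<inter> nats_between L U)" for k
  have "card (perfect_powers \<inter> nats_between L U) \<le> (\<Sum>k\<in>insert 2 {3..K}. c k)"
    unfolding c_def K_def using perfect_powers_between_subset[OF assms(1)]
    by (intro order_trans[OF card_mono card_UN_le]) auto
  then have "real (card (perfect_powers \<inter> nats_between L U))
      \<le> real (c 2) + (\<Sum>k\<in>{3..K}. real (c k))"
    by (simp flip: of_nat_sum of_nat_add)
  also have "\<dots> \<le> ((U - L) / sqrt L + 1) + log 2 U * ((U - L) / L powr (2/3) + 1)"
  proof (rule add_mono)
    show "real (c 2) \<le> (U - L) / sqrt L + 1"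
      using card_nth_powers_between_le[of 2 L U "1/2"] assms by (simp add: c_def powr_half_sqrt)
    have "(\<Sum>k\<in>{3..K}. real (c k)) \<le> (\<Sum>k\<in>{3..K}. (U - L) / L powr (2/3) + 1)"
      unfolding c_def using assms
      by (intro sum_mono card_nth_powers_between_le) (auto simp: field_simps)
    also have "\<dots> = real (K - 2) * ((U - L) / L powr (2/3) + 1)"
      by simp
    also have "\<dots> \<le> log 2 U * ((U - L) / L powr (2/3) + 1)"
    proof (rule mult_right_mono)
      have "log 2 U \<ge> 0"
        using assms by simp
      then show "real (K - 2) \<le> log 2 U"
        unfolding K_def by linarith
    qed (use assms in simp)
    finally show "(\<Sum>k\<in>{3..K}. real (c k)) \<le> log 2 U * ((U - L) / L powr (2/3) + 1)" .
  qed
  finally show ?thesis by simp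
qed

lemma eventually_card_perfect_powers_between_le:
  "\<forall>\<^sub>F L in at_top. \<forall>U. L \<le> U \<longrightarrow> U \<le> 4 * L \<longrightarrow>
    real (card (perfect_powers \<inter> nats_between L U)) \<le> 2 * ((U - L) / sqrt L) + 2 * log 2 L"
proof -
  have "\<forall>\<^sub>F L::real in at_top. log 2 (4 * L) / L powr (2/3) \<le> 1 / sqrt L"
    by real_asymp
  then show ?thesis
    using eventually_ge_at_top[of 8]
  proof (eventually_elim, intro allI impI)
    fix L U :: real
    assume log_small: "log 2 (4 * L) / L powr (2/3) \<le> 1 / sqrt L"
      and "8 \<le> L" and U: "L \<le> U" "U \<le> 4 * L"
    then have L: "1 < L"
      by simp
    have "log 2 8 \<le> log 2 L"
      using \<open>8 \<le> L\<close> by simp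
    moreover have "log 2 8 = 3" "log 2 4 = 2"
      using log_pow_cancel[of 2 3] log_pow_cancel[of 2 2] by simp_all
    ultimately have log_le: "1 + log 2 (4 * L) \<le> 2 * log 2 L"
      using L by (simp add: log_mult)
    have "real (card (perfect_powers \<inter> nats_between L U))
        \<le> (U - L) / sqrt L + 1 + log 2 U * ((U - L) / L powr (2/3) + 1)"
      using L U(1) by (rule card_perfect_powers_between_le)
    also have "\<dots> \<le> (U - L) / sqrt L + 1 + log 2 (4 * L) * ((U - L) / L powr (2/3) + 1)"
      using L U by (intro add_left_mono mult_right_mono log_mono) auto
    also have "\<dots> = (U - L) / sqrt L + (U - L) * (log 2 (4 * L) / L powr (2/3))
        + (1 + log 2 (4 * L))"
      by (simp add: algebra_simps)
    also have "\<dots> \<le> (U - L) / sqrt L + (U - L) * (1 / sqrt L) + 2 * log 2 L"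
      using log_small log_le U by (intro add_mono mult_left_mono) auto
    finally show "real (card (perfect_powers \<inter> nats_between L U))
        \<le> 2 * ((U - L) / sqrt L) + 2 * log 2 L"
      by simp
  qed
qed

lemma eventually_card_perfect_powers_around_le:
  "\<forall>\<^sub>F a in at_top. \<forall>r. 0 \<le> r \<longrightarrow> r \<le> a / 2 \<longrightarrow>
    real (card (perfect_powers \<inter> nats_between (a - r) (a + r)))
      \<le> 8 * (r / sqrt a) + 2 * log 2 a"
proof -
  obtain L\<^sub>0 where count: "\<And>L U. L\<^sub>0 \<le> L \<Longrightarrow> L \<le> U \<Longrightarrow> U \<le> 4 * L \<Longrightarrow>
      real (card (perfect_powers \<inter> nats_between L U)) \<le> 2 * ((U - L) / sqrt L) + 2 * log 2 L"
    using eventually_card_perfect_powers_between_le unfolding eventually_at_top_linorder by blast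
  show ?thesis
    using eventually_ge_at_top[of "max 1 (2 * L\<^sub>0)"]
  proof (eventually_elim, intro allI impI)
    fix a r :: real
    assume "max 1 (2 * L\<^sub>0) \<le> a" and r: "0 \<le> r" "r \<le> a / 2"
    then have a: "1 \<le> a" "2 * L\<^sub>0 \<le> a"
      by auto
    have "sqrt a / 2 \<le> sqrt (a - r)"
      using r a(1) by (intro real_le_rsqrt) (simp add: power_divide)
    then have "2 * r / sqrt (a - r) \<le> 2 * r / (sqrt a / 2)"
      using a(1) r(1) by (intro frac_le) auto
    moreover have "log 2 (a - r) \<le> log 2 a"
      using a(1) r by (intro log_mono) auto
    moreover have "real (card (perfect_powers \<inter> nats_between (a - r) (a + r)))
        \<le> 2 * ((a + r - (a - r)) / sqrt (a - r)) + 2 * log 2 (a - r)"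
      using a(2) r by (intro count) auto
    ultimately show "real (card (perfect_powers \<inter> nats_between (a - r) (a + r)))
        \<le> 8 * (r / sqrt a) + 2 * log 2 a"
      by simp
  qed
qed

definition neighbourhood :: "nat \<Rightarrow> nat set \<Rightarrow> nat set" where
  "neighbourhood d S = {x. \<exists>p\<in>S. \<bar>int x - int p\<bar> \<le> int d}"

lemma card_neighbourhood_between_le:
  "real (card (neighbourhood d S \<inter> nats_between l u)) \<le>
    real (card (S \<inter> nats_between (l - d) (u + d))) * (2 * real d + 1)"
proof -
  define T where "T = S \<inter> nats_between (l - d) (u + d)"
  have "finite T"
    by (simp add: T_def)
  have "neighbourhood d S \<inter> nats_between l u \<subseteq> (\<Union>p\<in>T. {p - d..p + d})"
  proof
    fix x assume x: "x \<in> neighbourhood d S \<inter> nats_between l u"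
    then obtain p where p: "p \<in> S" "\<bar>int x - int p\<bar> \<le> int d"
      by (auto simp: neighbourhood_def)
    then have "p \<le> x + d" "x \<le> p + d"
      by linarith+
    with x p(1) have "p \<in> T" "x \<in> {p - d..p + d}"
      by (auto simp: T_def)
    then show "x \<in> (\<Union>p\<in>T. {p - d..p + d})"
      by blast
  qed
  then have "card (neighbourhood d S \<inter> nats_between l u) \<le> (\<Sum>p\<in>T. card {p - d..p + d})"
    using \<open>finite T\<close> by (intro order_trans[OF card_mono card_UN_le]) auto
  also have "\<dots> \<le> card T * (2 * d + 1)"
    using sum_bounded_above[of T "\<lambda>p. card {p - d..p + d}" "2 * d + 1"] by simp
  finally have "real (card (neighbourhood d S \<inter> nats_between l u)) \<le> real (card T * (2 * d + 1))"
    by (rule of_nat_mono)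
  then show ?thesis
    by (simp add: T_def algebra_simps)
qed

lemma eventually_card_near_perfect_powers_le:
  "\<exists>K. \<forall>\<^sub>F a in at_top. \<forall>w. 1 \<le> w \<longrightarrow> w \<le> a / 4 \<longrightarrow>
    real (card (neighbourhood d perfect_powers \<inter> nats_between (a - w) (a + w)))
      \<le> K * (w / sqrt a + log 2 a)"
proof -
  define K where "K = 8 * (real d + 1)"
  show ?thesis
    using eventually_card_perfect_powers_around_le eventually_ge_at_top[of "max 1 (4 * real d)"]
  proof (intro exI[of _ "K * (2 * real d + 1)"], eventually_elim, intro allI impI)
    fix a w :: real
    assume powers: "\<forall>r. 0 \<le> r \<longrightarrow> r \<le> a / 2 \<longrightarrow>
        real (card (perfect_powers \<inter> nats_between (a - r) (a + r)))
          \<le> 8 * (r / sqrt a) + 2 * log 2 a"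
      and "max 1 (4 * real d) \<le> a" and w: "1 \<le> w" "w \<le> a / 4"
    then have a: "1 \<le> a" "4 * real d \<le> a"
      by auto
    define r where "r = w + d"
    have r: "0 \<le> r" "r \<le> a / 2"
      using a(2) w by (simp_all add: r_def)
    have "8 * r \<le> K * w"
      using mult_left_mono[OF w(1), of "real d"] by (simp add: r_def K_def algebra_simps)
    then have "8 * (r / sqrt a) \<le> K * (w / sqrt a)"
      using a(1) by (simp add: divide_right_mono)
    moreover have "2 * log 2 a \<le> K * log 2 a"
      using a(1) by (intro mult_right_mono) (auto simp: K_def)
    moreover have "real (card (perfect_powers \<inter> nats_between (a - r) (a + r)))
        \<le> 8 * (r / sqrt a) + 2 * log 2 a"
      using powers r by blast
    ultimately have card_powers: "real (card (perfect_powers \<inter> nats_between (a - r) (a + r)))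
        \<le> K * (w / sqrt a + log 2 a)"
      by (simp add: distrib_left)
    have "real (card (neighbourhood d perfect_powers \<inter> nats_between (a - w) (a + w)))
        \<le> real (card (perfect_powers \<inter> nats_between (a - r) (a + r))) * (2 * real d + 1)"
      using card_neighbourhood_between_le[of d perfect_powers "a - w" "a + w"]
      by (simp add: r_def diff_diff_eq add.assoc)
    also have "\<dots> \<le> K * (w / sqrt a + log 2 a) * (2 * real d + 1)"
      using card_powers by (rule mult_right_mono) simp
    finally show "real (card (neighbourhood d perfect_powers \<inter> nats_between (a - w) (a + w)))
        \<le> K * (2 * real d + 1) * (w / sqrt a + log 2 a)"
      by (simp add: mult_ac)
  qed
qed

lemma eventually_density_near_perfect_powers_le:
  fixes C :: real
  assumes "C > 0"
  shows "\<exists>K. \<forall>\<^sub>F a in at_top. \<forall>w. C * (sqrt a * ln a) \<le> w \<longrightarrow> w \<le> a / 4 \<longrightarrow>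
    real (card (neighbourhood d perfect_powers \<inter> nats_between (a - w) (a + w))) /
      real (card (nats_between (a - w) (a + w))) \<le> K / sqrt a"
proof -
  obtain K where K: "\<forall>\<^sub>F a in at_top. \<forall>w. 1 \<le> w \<longrightarrow> w \<le> a / 4 \<longrightarrow>
    real (card (neighbourhood d perfect_powers \<inter> nats_between (a - w) (a + w)))
      \<le> K * (w / sqrt a + log 2 a)"
    using eventually_card_near_perfect_powers_le by blast
  define K' where "K' = \<bar>K\<bar> * (1 + 1 / (C * ln 2))"
  have "\<forall>\<^sub>F a in at_top. 1 \<le> C * (sqrt a * ln a)"
    using assms by real_asymp
  with K show ?thesis
    using eventually_gt_at_top[of 1]
  proof (intro exI[of _ K'], eventually_elim, intro allI impI)
    fix a w :: real
    assume near: "\<forall>w. 1 \<le> w \<longrightarrow> w \<le> a / 4 \<longrightarrow>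
        real (card (neighbourhood d perfect_powers \<inter> nats_between (a - w) (a + w)))
          \<le> K * (w / sqrt a + log 2 a)"
      and "1 \<le> C * (sqrt a * ln a)" and a: "1 < a"
      and w_ge: "C * (sqrt a * ln a) \<le> w" and w_le: "w \<le> a / 4"
    then have w1: "1 \<le> w"
      by simp
    have "w \<le> real (card (nats_between (a - w) (a + w)))" (is "_ \<le> ?all")
      using card_nats_between_ge[of "a - w" "a + w"] w1 w_le by simp
    have log_le: "log 2 a \<le> w / sqrt a * (1 / (C * ln 2))"
      using w_ge assms a by (simp add: log_def field_simps)
    have "real (card (neighbourhood d perfect_powers \<inter> nats_between (a - w) (a + w)))
        \<le> K * (w / sqrt a + log 2 a)" (is "?near \<le> _")
      using near w1 w_le by blast
    also have "\<dots> \<le> \<bar>K\<bar> * (w / sqrt a + w / sqrt a * (1 / (C * ln 2)))"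
      using log_le a w1 by (intro mult_mono) auto
    also have "\<dots> = K' / sqrt a * w"
      by (simp add: K'_def algebra_simps add_divide_distrib)
    finally have "?near / ?all \<le> (K' / sqrt a * w) / w"
      using \<open>w \<le> ?all\<close> w1 by (intro frac_le) auto
    then show "?near / ?all \<le> K' / sqrt a"
      using w1 by simp
  qed
qed

lemma measure_uniform_measure_count_space:
  assumes "finite S"
  shows "measure (uniform_measure (count_space UNIV) S) T = real (card (T \<inter> S)) / real (card S)"
proof (cases "S = {}")
  case True
  then show ?thesis
    by (simp add: uniform_measure_def measure_def emeasure_density)
next
  case False
  with assms show ?thesis
    by (subst measure_uniform_measure) (auto simp: Int_commute)
qed

lemma sample_set_eq_nats_between:
  assumes "0 < A n" "\<epsilon> n < 1"
  shows "sample_set A \<epsilon> n = nats_between (A n - A n * \<epsilon> n) (A n + A n * \<epsilon> n)"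
proof -
  have "0 < A n * (1 - \<epsilon> n)"
    using assms by simp
  then have "1 \<le> x" if "A n * (1 - \<epsilon> n) \<le> real x" for x
    using that by (cases x) auto
  then show ?thesis
    by (auto simp: sample_set_def algebra_simps)
qed

lemma eventually_measure_near_perfect_powers_le:
  assumes A_lim: "filterlim A at_top sequentially"
    and eps_lim: "\<epsilon> \<longlonglongrightarrow> 0"
    and eps_large: "\<exists>C>0. \<forall>\<^sub>F n in sequentially. \<epsilon> n \<ge> C * (ln (A n) / sqrt (A n))"
  shows "\<exists>K. \<forall>\<^sub>F n in sequentially.
    measure (uniform_measure (count_space UNIV) (sample_set A \<epsilon> n))
      (neighbourhood d perfect_powers) \<le> K * A n powr (- 1 / 2)"
proof -
  obtain C where C: "C > 0" "\<forall>\<^sub>F n in sequentially. \<epsilon> n \<ge> C * (ln (A n) / sqrt (A n))"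
    using eps_large by blast
  obtain K where K: "\<forall>\<^sub>F a in at_top. \<forall>w. C * (sqrt a * ln a) \<le> w \<longrightarrow> w \<le> a / 4 \<longrightarrow>
    real (card (neighbourhood d perfect_powers \<inter> nats_between (a - w) (a + w))) /
      real (card (nats_between (a - w) (a + w))) \<le> K / sqrt a"
    using eventually_density_near_perfect_powers_le[OF C(1)] by blast
  have A_pos: "\<forall>\<^sub>F n in sequentially. 0 < A n"
    using A_lim by (simp add: filterlim_at_top_dense)
  have eps_small: "\<forall>\<^sub>F n in sequentially. \<epsilon> n < 1/4"
    using eps_lim by (rule order_tendstoD) simp
  show ?thesis
  proof (intro exI[of _ K],
      use eventually_compose_filterlim[OF K A_lim] C(2) A_pos eps_small in eventually_elim)
    case (elim n)
    then have "sample_set A \<epsilon> n = nats_between (A n - A n * \<epsilon> n) (A n + A n * \<epsilon> n)"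
      by (intro sample_set_eq_nats_between) auto
    moreover have "C * (sqrt (A n) * ln (A n)) \<le> A n * \<epsilon> n"
    proof -
      have "C * (sqrt (A n) * ln (A n)) = C * (A n / sqrt (A n) * ln (A n))"
        using elim(3) by (simp only: real_div_sqrt less_imp_le)
      also have "\<dots> = A n * (C * (ln (A n) / sqrt (A n)))"
        by simp
      also have "\<dots> \<le> A n * \<epsilon> n"
        using elim(2,3) by (intro mult_left_mono) auto
      finally show ?thesis .
    qed
    moreover have "A n * \<epsilon> n \<le> A n / 4"
      using mult_left_mono[of "\<epsilon> n" "1/4" "A n"] elim(3,4) by simp
    ultimately have "measure (uniform_measure (count_space UNIV) (sample_set A \<epsilon> n))
        (neighbourhood d perfect_powers) \<le> K / sqrt (A n)"
      using elim(1) by (simp add: measure_uniform_measure_count_space)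
    also have "\<dots> = K * A n powr (- 1 / 2)"
      using elim powr_minus_divide[of "A n" "1/2"] by (simp add: powr_half_sqrt)
    finally show ?case .
  qed
qed

lemma near_perfect_power_if_power_dist_le:
  assumes "k \<ge> 2" "power_dist g k n \<le> d"
  shows "g n \<in> neighbourhood d perfect_powers"
proof -
  have "power_dist g k n \<in> range (\<lambda>m::int. nat \<bar>int (g n) - m ^ k\<bar>)"
    unfolding power_dist_def by (rule Inf_nat_def1) auto
  with assms(2) obtain m :: int where m: "\<bar>int (g n) - m ^ k\<bar> \<le> int d"
    by (force simp: nat_le_iff)
  have "\<exists>p. is_nth_power k p \<and> \<bar>int (g n) - int p\<bar> \<le> int d"
  proof (cases "0 < m ^ k")
    case True
    then have "m ^ k = int (nat \<bar>m\<bar> ^ k)"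
      by (simp flip: power_abs)
    with m show ?thesis
      by (metis is_nth_power_nth_power)
  next
    case False
    with m have "\<bar>int (g n) - int 0\<bar> \<le> int d"
      by linarith
    with assms(1) show ?thesis
      by (intro exI[of _ 0]) simp
  qed
  with assms(1) show ?thesis
    by (auto simp: neighbourhood_def perfect_powers_def)
qed

lemma max_index_le:
  assumes "\<And>n. n \<ge> 1 \<Longrightarrow> power_dist g k n \<le> d \<Longrightarrow> n \<le> B"
  shows "max_index g k d \<le> enat B"
proof -
  let ?N = "{n. 1 \<le> n \<and> power_dist g k n \<le> d}"
  have bounded: "?N \<subseteq> {..B}"
    using assms by auto
  then have "finite ?N"
    by (rule finite_subset) simp
  then show ?thesis
    using bounded Max_in[of ?N] by (auto simp: max_index_def Let_def)
qed

lemma bounded_max_index: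
  assumes "\<forall>\<^sub>F n in sequentially. g n \<notin> neighbourhood d perfect_powers"
  shows "\<exists>B. \<forall>k\<ge>2. max_index g k d \<le> enat B"
proof -
  obtain B where B: "\<And>n. n \<ge> B \<Longrightarrow> g n \<notin> neighbourhood d perfect_powers"
    using assms by (auto simp: eventually_sequentially)
  have "max_index g k d \<le> enat B" if "k \<ge> 2" for k
    using B near_perfect_power_if_power_dist_le[OF that] by (intro max_index_le) (meson nat_le_linear)
  then show ?thesis
    by blast
qed

theorem theorem7p8:
  fixes A \<epsilon> :: "nat \<Rightarrow> real"
    and P :: "'a measure"
    and f :: "nat \<Rightarrow> 'a \<Rightarrow> nat"
    and d :: nat
  assumes A_pos: "\<And>n. n \<ge> 1 \<Longrightarrow> A n > 0"
    and A_lim: "filterlim A at_top sequentially"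
    and A_sum: "summable (\<lambda>n. A (Suc n) powr (- 1 / 2))"
    and eps_pos: "\<And>n. n \<ge> 1 \<Longrightarrow> \<epsilon> n > 0"
    and eps_lim: "\<epsilon> \<longlonglongrightarrow> 0"
    and eps_large: "\<exists>C>0. \<forall>\<^sub>F n in sequentially. \<epsilon> n \<ge> C * (ln (A n) / sqrt (A n))"
    and P_prob: "prob_space P"
    and f_meas: "\<And>n. n \<ge> 1 \<Longrightarrow> f n \<in> measurable P (count_space UNIV)"
    and f_unif: "\<And>n. n \<ge> 1 \<Longrightarrow>
      distr P (count_space UNIV) (f n) = uniform_measure (count_space UNIV) (sample_set A \<epsilon> n)"
  shows "AE \<omega> in P. \<exists>B::nat. \<forall>k\<ge>2. max_index (\<lambda>n. f n \<omega>) k d \<le> enat B"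
proof -
  interpret prob_space P by fact
  let ?N = "neighbourhood d perfect_powers"
  define E where "E n = f n -` ?N \<inter> space P" for n
  have E_event: "E (Suc n) \<in> events" for n
    unfolding E_def by (rule measurable_sets[OF f_meas]) auto
  obtain K where K: "\<forall>\<^sub>F n in sequentially.
      measure (uniform_measure (count_space UNIV) (sample_set A \<epsilon> n)) ?N \<le> K * A n powr (- 1 / 2)"
    using eventually_measure_near_perfect_powers_le[OF A_lim eps_lim eps_large] by blast
  have "\<forall>\<^sub>F n in sequentially. prob (E (Suc n)) \<le> K * A (Suc n) powr (- 1 / 2)"
    using eventually_compose_filterlim[OF K filterlim_Suc] f_meas
    by (simp add: E_def measure_distr flip: f_unif)
  then have "summable (\<lambda>n. prob (E (Suc n)))"
    by (intro summable_comparison_test_ev[OF _ summable_mult[OF A_sum]]) simp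
  then have "AE \<omega> in P. \<forall>\<^sub>F n in sequentially. \<omega> \<in> space P - E (Suc n)"
    using E_event by (intro borel_cantelli_AE1) (auto simp: emeasure_eq_measure)
  then show ?thesis
  proof eventually_elim
    case (elim \<omega>)
    then have "\<forall>\<^sub>F n in sequentially. f (Suc n) \<omega> \<notin> ?N"
      by eventually_elim (auto simp: E_def)
    then show ?case
      by (intro bounded_max_index) (rule eventually_sequentially_Suc[THEN iffD1])
  qed
qed

end
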